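(* Let $A$ be a real $M\times N$ matrix, let $a_j<b_j$ be real numbers for $j=1,\dots,N$, let $\mathcal{K}=\prod_{j=1}^N[a_j,b_j]$, and let $y_1,y_2\in A(\mathcal{K})\subset\mathbb{R}^M$. For $i=1,2$ let $(x_i^*,\lambda_i^* )\in\mathcal{K}\times\mathbb{R}^M$ be a solution, for the data $y_i$, of the problem of minimizing $\Psi(x)$ over $x\in\mathcal{K}$ subject to $Ax=y_i$ by Lagrange multipliers; that is, $Ax_i^*=y_i$ and $x_i^*$ minimizes $x\mapsto\mathcal{L}(x,\lambda_i^*,y_i)$ over $\mathcal{K}$, where $$\mathcal{L}(x,\lambda,y)=\Psi(x)+\lambda^t(Ax-y).$$ Then $$(\lambda_1^*-\lambda_2^* )^t(y_1-y_2)\le 0,$$ and equivalently $$(A^t\lambda_1^*-A^t\lambda_2^* )^t(x_1^*-x_2^* )\le 0.$$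
   Context: With $D_j=b_j-a_j$ and the convention $0\ln0=0$, the function $\Psi:\mathcal{K}\to\mathbb{R}$ is $$\Psi(x)=\sum_{j=1}^N\left[\frac{x_j-a_j}{D_j}\ln\left(\frac{x_j-a_j}{D_j}\right)+\frac{b_j-x_j}{D_j}\ln\left(\frac{b_j-x_j}{D_j}\right)\right].$$ The superscript $t$ denotes transpose. *)

theory Defs
  imports "HOL-Analysis.Analysis"
begin

(* The convention 0 ln 0 = 0 holds automatically for the product t * ln t at t = 0.
   The function is only meaningful for x in the box cbox a b; its values elsewhere are never used. *)
definition Psi :: "real ^ 'n \<Rightarrow> real ^ 'n \<Rightarrow> real ^ 'n \<Rightarrow> real" where
  "Psi a b x =
    (\<Sum>j\<in>UNIV.
       (x $ j - a $ j) / (b $ j - a $ j) * ln ((x $ j - a $ j) / (b $ j - a $ j))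
     + (b $ j - x $ j) / (b $ j - a $ j) * ln ((b $ j - x $ j) / (b $ j - a $ j)))"

definition Lagrangian ::
  "real ^ 'n ^ 'm \<Rightarrow> real ^ 'n \<Rightarrow> real ^ 'n \<Rightarrow> real ^ 'n \<Rightarrow> real ^ 'm \<Rightarrow> real ^ 'm \<Rightarrow> real" where
  "Lagrangian A a b x lam y = Psi a b x + lam \<bullet> (A *v x - y)"

(* For vectors in real ^ 'n, cbox a b is the product of the intervals [a_j, b_j]. *)
definition lagrange_solution ::
  "real ^ 'n ^ 'm \<Rightarrow> real ^ 'n \<Rightarrow> real ^ 'n \<Rightarrow> real ^ 'm \<Rightarrow> real ^ 'n \<Rightarrow> real ^ 'm \<Rightarrow> bool" where
  "lagrange_solution A a b y x lam \<longleftrightarrow>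
     A *v x = y \<and> is_arg_min (\<lambda>z. Lagrangian A a b z lam y) (\<lambda>z. z \<in> cbox a b) x"

end

theory Submission
  imports Defs
begin

text \<open>
  The data enter the Lagrangian only through their pairing with the multiplier, and two
  optimality comparisons suffice. Each primal solution lies in the box and is therefore a competitor
  in the minimization that defines the other one. In each comparison the constraint term
  vanishes at the minimizer and equals the multiplier paired with the difference of the data
  at the competitor. Adding the two comparisons cancels the values of the objective and leaves
  the sign of the pairing (lemma \<open>lagrange_solution_compare\<close>). The second form of
  the inequality is the first one with \<open>A\<close> moved to the other side of the inner
  product.
\<close>

text \<open>
  Minimality of \<open>x\<close> tested against a solution for other data \<open>y'\<close>: the
  perturbation inequality saying that \<open>- lam\<close> is a subgradient of the optimal value
  as a function of the data.
\<close>

lemma lagrange_solution_compare: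
  assumes "lagrange_solution A a b y x lam" and "lagrange_solution A a b y' x' lam'"
  shows "Psi a b x \<le> Psi a b x' + lam \<bullet> (y' - y)"
proof -
  have "Lagrangian A a b x lam y \<le> Lagrangian A a b x' lam y"
    using assms unfolding lagrange_solution_def is_arg_min_linorder by blast
  then show ?thesis
    using assms unfolding lagrange_solution_def Lagrangian_def by simp
qed

theorem mainTheorem5:
  fixes A :: "real ^ 'n ^ 'm"
    and a b x1 x2 :: "real ^ 'n"
    and y1 y2 lam1 lam2 :: "real ^ 'm"
  assumes "\<And>j. a $ j < b $ j"
    and "y1 \<in> (\<lambda>x. A *v x) ` cbox a b"
    and "y2 \<in> (\<lambda>x. A *v x) ` cbox a b"
    and "lagrange_solution A a b y1 x1 lam1"
    and "lagrange_solution A a b y2 x2 lam2"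
  shows "(lam1 - lam2) \<bullet> (y1 - y2) \<le> 0
       \<and> (transpose A *v lam1 - transpose A *v lam2) \<bullet> (x1 - x2) \<le> 0"
proof -
  have main: "(lam1 - lam2) \<bullet> (y1 - y2) \<le> 0"
    using lagrange_solution_compare[OF assms(4,5)] lagrange_solution_compare[OF assms(5,4)]
    by (simp add: inner_diff_left inner_diff_right)
  have "(transpose A *v lam1 - transpose A *v lam2) \<bullet> (x1 - x2)
      = (transpose A *v (lam1 - lam2)) \<bullet> (x1 - x2)"
    by (simp only: matrix_vector_mult_diff_distrib)
  also have "\<dots> = (lam1 - lam2) \<bullet> (A *v (x1 - x2))"
    by (simp only: transpose_matrix_vector dot_lmul_matrix)
  also have "\<dots> = (lam1 - lam2) \<bullet> (y1 - y2)"
    using assms(4,5) by (simp add: lagrange_solution_def matrix_vector_mult_diff_distrib)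
  finally show ?thesis
    using main by simp
qed

end
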